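(* Let $(\mathcal H_k,\delta_i)_{k,i}$ be a semi-cosimplicial Hilbert space (SCH) with associated partial shifts $(\alpha_n)_{n\ge 0}$ on $\mathcal H_\infty$ and innovation spaces $(\mathcal D_k)_{k\ge -1}$. (I) For each $n\in\mathbb N_0$ the following two implications hold: if $\alpha_n(\mathcal D_k)\subset\mathcal D_{k+1}$ for all $k\ge n$, then the SCH is saturated at level $n-1$ (i.e. $\mathcal H_{n-1}=\mathcal H_\infty^{\alpha_n}$); and if the SCH is saturated at level $n-1$, then $\alpha_i(\mathcal D_n)\subset\mathcal D_{n+1}$ for all $0\le i\le n$. (II) The following assertions are equivalent: (1) The SCH $(\mathcal H_k,\delta_i)_{k,i}$ is saturated. (2) $\alpha_i(\mathcal D_n)\subset\mathcal D_{n+1}$ for all $i,n\in\mathbb N_0$ with $0\le i\le n$. (3) $\alpha_n(\mathcal D_n)\subset\mathcal D_{n+1}$ for all $n\in\mathbb N_0$.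
   Context: A semi-cosimplicial Hilbert space (SCH) $(\mathcal H_k,\delta_i)_{k,i}$ is a sequence $(\mathcal H_k)_{k\ge -1}$ of Hilbert spaces together with linear isometries $\delta_i:\mathcal H_{n-1}\to\mathcal H_n$ (for all $n\in\mathbb N_0=\{0,1,2,\dots\}$ and $i=0,\dots,n$; the dependence on $n$ is suppressed) satisfying $\delta_j\delta_i=\delta_i\delta_{j-1}$ for $0\le i<j\le n$ (as maps $\mathcal H_{n-2}\to\mathcal H_n$). The maps $\delta_n:\mathcal H_{n-1}\to\mathcal H_n$ (top index) are regarded as embeddings, giving a tower $\mathcal H_{-1}\subset\mathcal H_0\subset\mathcal H_1\subset\cdots$, and $\mathcal H_\infty$ is the Hilbert space closure of $\bigcup_{k\ge-1}\mathcal H_k$. The associated partial shifts are the isometries $\alpha_n:\mathcal H_\infty\to\mathcal H_\infty$, $n\in\mathbb N_0$, determined by $\alpha_n|_{\mathcal H_k}=\delta_n:\mathcal H_k\to\mathcal H_{k+1}$ for all $k\ge n-1$. They satisfy $\alpha_j\alpha_i=\alpha_i\alpha_{j-1}$ for $0\le i<j$, $\alpha_n$ fixes $\mathcal H_{n-1}$ pointwise, and $\alpha_n(\mathcal H_k)\subset\mathcal H_{k+1}$. For an operator $\alpha$ on $\mathcal H_\infty$, $\mathcal H_\infty^{\alpha}$ denotes its fixed point space. The innovation spaces are $\mathcal D_{-1}:=\mathcal H_{-1}$ and $\mathcal D_n:=\mathcal H_n\ominus\mathcal H_{n-1}$ for $n\in\mathbb N_0$. The SCH is saturated at level $m$ if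 $\mathcal H_m=\mathcal H_\infty^{\alpha_{m+1}}$, and saturated if this holds for all $m\ge-1$. *)

theory Defs
  imports "HOL-Analysis.Analysis"
begin

text \<open>
  The scalars of a Hilbert space are the real or the complex numbers. Both are instances of the
  class \<open>rc_scalar\<close>, and by Mazur's theorem every instance is isomorphic to one of them.
\<close>

class scnj =
  fixes scnj :: "'a \<Rightarrow> 'a"

class rc_scalar = real_normed_field + scnj +
  assumes scnj_add: "scnj (x + y) = scnj x + scnj y"
    and scnj_mult: "scnj (x * y) = scnj x * scnj y"
    and scnj_scaleR: "scnj (r *\<^sub>R x) = r *\<^sub>R scnj x"
    and mult_scnj: "x * scnj x = (norm x)\<^sup>2 *\<^sub>R 1"

instantiation real :: rc_scalar
begin
definition scnj_real :: "real \<Rightarrow> real" where "scnj_real x = x"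
instance by standard (auto simp: scnj_real_def power2_eq_square)
end

instantiation complex :: rc_scalar
begin
definition scnj_complex :: "complex \<Rightarrow> complex" where "scnj_complex = cnj"
instance
  by standard
    (simp_all add: scnj_complex_def scaleR_conv_of_real flip: complex_norm_square)
end

text \<open>
  A Hilbert space structure on a type that already carries a complete norm: the norm is the one
  induced by the inner product, which is linear in its second argument.
\<close>

locale hilbert_space = vector_space scale
  for scale :: "'k::rc_scalar \<Rightarrow> 'a::banach \<Rightarrow> 'a" +
  fixes ip :: "'a \<Rightarrow> 'a \<Rightarrow> 'k"
  assumes scale_of_real: "scale (of_real r) x = r *\<^sub>R x"
    and ip_add_right: "ip x (y + z) = ip x y + ip x z"
    and ip_scale_right: "ip x (scale c y) = c * ip x y"
    and ip_commute: "ip y x = scnj (ip x y)"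
    and ip_self: "ip x x = of_real ((norm x)\<^sup>2)"

lemma hilbert_space_real:
  "hilbert_space (scaleR :: real \<Rightarrow> 'a::{real_inner, banach} \<Rightarrow> 'a) inner"
  by unfold_locales
    (simp_all add: scaleR_add_right scaleR_add_left inner_add_right scnj_real_def
      inner_commute power2_norm_eq_inner)

definition linear_isometry_on ::
  "('k \<Rightarrow> 'a \<Rightarrow> 'a) \<Rightarrow> ('k \<Rightarrow> 'b \<Rightarrow> 'b) \<Rightarrow>
   'a::real_normed_vector set \<Rightarrow> 'b::real_normed_vector set \<Rightarrow> ('a \<Rightarrow> 'b) \<Rightarrow> bool"
  where "linear_isometry_on s s' A B f \<longleftrightarrow>
    f ` A \<subseteq> B \<and>
    (\<forall>x\<in>A. \<forall>y\<in>A. f (x + y) = f x + f y) \<and>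
    (\<forall>c. \<forall>x\<in>A. f (s c x) = s' c (f x)) \<and>
    (\<forall>x\<in>A. norm (f x) = norm x)"

text \<open>
  The spaces \<open>H k\<close> (\<open>k \<ge> -1\<close>) are closed subspaces of one ambient Hilbert space. This is
  no restriction: any sequence of Hilbert spaces can be placed in its Hilbert space direct sum, and
  no inclusions between the \<open>H k\<close> are assumed. The map \<open>\<delta> n i\<close> is
  \<open>\<delta>\<^sub>i : H (n - 1) \<rightarrow> H n\<close>, the first argument being the index of the target.
\<close>

locale semi_cosimplicial_hilbert_space = hilbert_space scale ip
  for scale :: "'k::rc_scalar \<Rightarrow> 'a::banach \<Rightarrow> 'a" and ip :: "'a \<Rightarrow> 'a \<Rightarrow> 'k" +
  fixes H :: "int \<Rightarrow> 'a set" and \<delta> :: "int \<Rightarrow> int \<Rightarrow> 'a \<Rightarrow> 'a"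
  assumes H_subspace: "-1 \<le> k \<Longrightarrow> subspace (H k)"
    and H_closed: "-1 \<le> k \<Longrightarrow> closed (H k)"
    and delta_isometry:
      "0 \<le> i \<Longrightarrow> i \<le> n \<Longrightarrow> linear_isometry_on scale scale (H (n - 1)) (H n) (\<delta> n i)"
    and cosimplicial_identity:
      "0 \<le> i \<Longrightarrow> i < j \<Longrightarrow> j \<le> n \<Longrightarrow> x \<in> H (n - 2) \<Longrightarrow>
        \<delta> n j (\<delta> (n - 1) i x) = \<delta> n i (\<delta> (n - 1) (j - 1) x)"

text \<open>
  The passage to the tower: Hilbert space embeddings \<open>\<iota> k\<close> of the \<open>H k\<close> into a common Hilbert
  space that turn the top maps \<open>\<delta> n n\<close> into inclusions. Such embeddings are unique up to a
  unitary between the closures of the unions of their ranges.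
\<close>

locale semi_cosimplicial_tower =
  semi_cosimplicial_hilbert_space scale ip H \<delta> + lim: hilbert_space scale' ip'
  for scale :: "'k::rc_scalar \<Rightarrow> 'a::banach \<Rightarrow> 'a" and ip :: "'a \<Rightarrow> 'a \<Rightarrow> 'k"
    and H :: "int \<Rightarrow> 'a set" and \<delta> :: "int \<Rightarrow> int \<Rightarrow> 'a \<Rightarrow> 'a"
    and scale' :: "'k \<Rightarrow> 'b::banach \<Rightarrow> 'b" and ip' :: "'b \<Rightarrow> 'b \<Rightarrow> 'k" +
  fixes \<iota> :: "int \<Rightarrow> 'a \<Rightarrow> 'b"
  assumes emb_isometry: "-1 \<le> k \<Longrightarrow> linear_isometry_on scale scale' (H k) UNIV (\<iota> k)"
    and emb_top: "0 \<le> n \<Longrightarrow> x \<in> H (n - 1) \<Longrightarrow> \<iota> n (\<delta> n n x) = \<iota> (n - 1) x"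

definition tower :: "(int \<Rightarrow> 'a set) \<Rightarrow> (int \<Rightarrow> 'a \<Rightarrow> 'b) \<Rightarrow> int \<Rightarrow> 'b set"
  where "tower H \<iota> k = \<iota> k ` H k"

definition tower_limit :: "(int \<Rightarrow> 'b::topological_space set) \<Rightarrow> 'b set"
  where "tower_limit T = closure (\<Union>k\<in>{-1..}. T k)"

definition innovation :: "('b \<Rightarrow> 'b \<Rightarrow> 'k::zero) \<Rightarrow> (int \<Rightarrow> 'b set) \<Rightarrow> int \<Rightarrow> 'b set"
  where "innovation ip' T n =
    (if n = -1 then T (-1) else {x \<in> T n. \<forall>y\<in>T (n - 1). ip' y x = 0})"

definition saturated_at ::
  "(int \<Rightarrow> 'b::topological_space set) \<Rightarrow> (int \<Rightarrow> 'b \<Rightarrow> 'b) \<Rightarrow> int \<Rightarrow> bool"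
  where "saturated_at T \<alpha> m \<longleftrightarrow> T m = {x \<in> tower_limit T. \<alpha> (m + 1) x = x}"

definition saturated ::
  "(int \<Rightarrow> 'b::topological_space set) \<Rightarrow> (int \<Rightarrow> 'b \<Rightarrow> 'b) \<Rightarrow> bool"
  where "saturated T \<alpha> \<longleftrightarrow> (\<forall>m\<ge>-1. saturated_at T \<alpha> m)"

text \<open>
  Values of a partial shift outside \<open>tower_limit\<close> are irrelevant. Existence, and uniqueness on
  \<open>tower_limit\<close>, are proved below.
\<close>

definition partial_shift ::
  "('k \<Rightarrow> 'b \<Rightarrow> 'b) \<Rightarrow> (int \<Rightarrow> 'a set) \<Rightarrow> (int \<Rightarrow> int \<Rightarrow> 'a \<Rightarrow> 'a) \<Rightarrow>
   (int \<Rightarrow> 'a \<Rightarrow> 'b::real_normed_vector) \<Rightarrow> int \<Rightarrow> ('b \<Rightarrow> 'b) \<Rightarrow> bool"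
  where "partial_shift scale' H \<delta> \<iota> n f \<longleftrightarrow>
    linear_isometry_on scale' scale'
      (tower_limit (tower H \<iota>)) (tower_limit (tower H \<iota>)) f \<and>
    (\<forall>k\<ge>n - 1. \<forall>x\<in>H k. f (\<iota> k x) = \<iota> (k + 1) (\<delta> (k + 1) n x))"

lemma (in hilbert_space) norm_scale: "norm (scale c x) = norm c * norm x"
proof -
  have "scnj (1 :: 'k) = 1" using mult_scnj[of "1 :: 'k"] by simp
  then have sr: "scnj (of_real r) = (of_real r :: 'k)" for r
    by (simp add: of_real_def scnj_scaleR)
  have "of_real ((norm (scale c x))\<^sup>2) = ip (scale c x) (scale c x)" by (simp only: ip_self)
  also have "\<dots> = c * (scnj c * scnj (ip x x))"
    using ip_commute[of "scale c x" x] by (simp only: ip_scale_right scnj_mult)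
  also have "\<dots> = (c * scnj c) * of_real ((norm x)\<^sup>2)"
    by (simp only: ip_self sr mult.assoc)
  also have "\<dots> = of_real ((norm c * norm x)\<^sup>2)"
    by (simp add: mult_scnj of_real_def power_mult_distrib)
  finally have "(norm (scale c x))\<^sup>2 = (norm c * norm x)\<^sup>2" by (simp only: of_real_eq_iff)
  then show ?thesis by simp
qed

lemma (in hilbert_space) continuous_on_scale: "continuous_on A (scale c)"
proof -
  have "dist (scale c x) (scale c y) = norm c * dist x y" for x y
    by (simp add: dist_norm norm_scale flip: scale_right_diff_distrib)
  then have "(norm c)-lipschitz_on A (scale c)" by (auto intro: lipschitz_onI)
  then show ?thesis by (rule lipschitz_on_continuous_on)
qed

context semi_cosimplicial_tower
begin

lemma emb_closure:
  assumes n: "0 \<le> n"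
  shows "tower_limit (tower H \<iota>) = closure (\<Union>k\<in>{n - 1..}. \<iota> k ` H k)"
proof -
  have emb_step: "\<iota> k ` H k \<subseteq> \<iota> (k + 1) ` H (k + 1)" if "-1 \<le> k" for k
  proof
    fix u assume "u \<in> \<iota> k ` H k"
    then obtain x where x: "x \<in> H k" "u = \<iota> k x" by blast
    have "\<delta> (k + 1) (k + 1) x \<in> H (k + 1)"
      using delta_isometry[of "k + 1" "k + 1"] that x(1) by (simp add: linear_isometry_on_def image_subset_iff)
    moreover have "\<iota> (k + 1) (\<delta> (k + 1) (k + 1) x) = u"
      using emb_top[of "k + 1" x] that x by simp
    ultimately show "u \<in> \<iota> (k + 1) ` H (k + 1)" by (metis imageI)
  qed
  have mono: "\<iota> k ` H k \<subseteq> \<iota> l ` H l" if "-1 \<le> k" "k \<le> l" for k l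
    using that(2)
  proof (induction l rule: int_ge_induct)
    case (step l)
    show ?case
      using step.IH emb_step[of l] that(1) step.hyps by (meson order_trans)
  qed simp
  have "(\<Union>k\<in>{-1..}. \<iota> k ` H k) = (\<Union>k\<in>{n - 1..}. \<iota> k ` H k)"
  proof (rule equalityI)
    show "(\<Union>k\<in>{-1..}. \<iota> k ` H k) \<subseteq> (\<Union>k\<in>{n - 1..}. \<iota> k ` H k)"
    proof
      fix u assume "u \<in> (\<Union>k\<in>{-1..}. \<iota> k ` H k)"
      then obtain k where "-1 \<le> k" "u \<in> \<iota> k ` H k" by blast
      then have "u \<in> \<iota> (max k (n - 1)) ` H (max k (n - 1))"
        using mono[of k "max k (n - 1)"] by fastforce
      then show "u \<in> (\<Union>k\<in>{n - 1..}. \<iota> k ` H k)"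
        by (intro UN_I[of "max k (n - 1)"]) simp_all
    qed
    show "(\<Union>k\<in>{n - 1..}. \<iota> k ` H k) \<subseteq> (\<Union>k\<in>{-1..}. \<iota> k ` H k)"
      using n by (intro UN_mono order_refl) simp
  qed
  then show ?thesis by (simp add: tower_limit_def tower_def)
qed

definition shift_graph :: "int \<Rightarrow> 'b \<Rightarrow> 'b \<Rightarrow> bool"
  where "shift_graph n u v \<longleftrightarrow>
    (\<exists>k\<ge>n - 1. \<exists>x\<in>H k. u = \<iota> k x \<and> v = \<iota> (k + 1) (\<delta> (k + 1) n x))"

lemma shift_graph_lift:
  assumes n: "0 \<le> n" and k: "n - 1 \<le> k" and x: "x \<in> H k" and "k \<le> l"
  shows "\<exists>y\<in>H l. \<iota> l y = \<iota> k x \<and> \<iota> (l + 1) (\<delta> (l + 1) n y) = \<iota> (k + 1) (\<delta> (k + 1) n x)"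
  using \<open>k \<le> l\<close>
proof (induction l rule: int_ge_induct)
  case base
  then show ?case using x by blast
next
  case (step l)
  then obtain y where y: "y \<in> H l" "\<iota> l y = \<iota> k x"
      "\<iota> (l + 1) (\<delta> (l + 1) n y) = \<iota> (k + 1) (\<delta> (k + 1) n x)"
    by blast
  let ?y = "\<delta> (l + 1) (l + 1) y"
  have l: "n \<le> l + 1" using k step.hyps by simp
  have "?y \<in> H (l + 1)"
    using delta_isometry[of "l + 1" "l + 1"] n l y(1) by (auto simp: linear_isometry_on_def)
  moreover have "\<iota> (l + 1) ?y = \<iota> k x"
    using emb_top[of "l + 1" y] n l y by simp
  moreover have "\<iota> (l + 1 + 1) (\<delta> (l + 1 + 1) n ?y) = \<iota> (k + 1) (\<delta> (k + 1) n x)"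
  proof -
    have "\<delta> (l + 2) n ?y = \<delta> (l + 2) (l + 2) (\<delta> (l + 1) n y)"
      using cosimplicial_identity[of n "l + 2" "l + 2" y] n l y(1)
      by (simp add: algebra_simps)
    moreover have "\<delta> (l + 1) n y \<in> H (l + 1)"
      using delta_isometry[of n "l + 1"] n l y(1) by (auto simp: linear_isometry_on_def)
    ultimately show ?thesis
      using emb_top[of "l + 2" "\<delta> (l + 1) n y"] n l y(3) by (simp add: algebra_simps)
  qed
  ultimately show ?case by blast
qed

lemma shift_graph_add:
  assumes n: "0 \<le> n" and "shift_graph n u v" "shift_graph n u' v'"
  shows "shift_graph n (u + u') (v + v')"
proof -
  from assms obtain k x k' x' where
    k: "n - 1 \<le> k" "x \<in> H k" "u = \<iota> k x" "v = \<iota> (k + 1) (\<delta> (k + 1) n x)" and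
    k': "n - 1 \<le> k'" "x' \<in> H k'" "u' = \<iota> k' x'" "v' = \<iota> (k' + 1) (\<delta> (k' + 1) n x')"
    unfolding shift_graph_def by blast
  define l where "l = max k k'"
  obtain y where y: "y \<in> H l" "\<iota> l y = u" "\<iota> (l + 1) (\<delta> (l + 1) n y) = v"
    using shift_graph_lift[OF n k(1,2), of l] k(3,4) by (auto simp: l_def)
  obtain y' where y': "y' \<in> H l" "\<iota> l y' = u'" "\<iota> (l + 1) (\<delta> (l + 1) n y') = v'"
    using shift_graph_lift[OF n k'(1,2), of l] k'(3,4) by (auto simp: l_def)
  have l: "n - 1 \<le> l" using k(1) by (simp add: l_def)
  have "y + y' \<in> H l" using H_subspace[of l] n l y(1) y'(1) by (simp add: subspace_add)
  moreover have "\<iota> l (y + y') = u + u'"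
    using emb_isometry[of l] n l y y' by (simp add: linear_isometry_on_def)
  moreover have "\<iota> (l + 1) (\<delta> (l + 1) n (y + y')) = v + v'"
    using emb_isometry[of "l + 1"] delta_isometry[of n "l + 1"] n l y y'
    by (simp add: linear_isometry_on_def image_subset_iff)
  ultimately show ?thesis unfolding shift_graph_def using l by metis
qed

lemma shift_graph_scale:
  assumes n: "0 \<le> n" and "shift_graph n u v"
  shows "shift_graph n (scale' c u) (scale' c v)"
proof -
  from assms obtain k x where
    k: "n - 1 \<le> k" "x \<in> H k" "u = \<iota> k x" "v = \<iota> (k + 1) (\<delta> (k + 1) n x)"
    unfolding shift_graph_def by blast
  have "scale c x \<in> H k" using H_subspace[of k] n k by (simp add: subspace_scale)
  moreover have "\<iota> k (scale c x) = scale' c u"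
    using emb_isometry[of k] n k by (simp add: linear_isometry_on_def)
  moreover have "\<iota> (k + 1) (\<delta> (k + 1) n (scale c x)) = scale' c v"
    using emb_isometry[of "k + 1"] delta_isometry[of n "k + 1"] n k
    by (simp add: linear_isometry_on_def image_subset_iff)
  ultimately show ?thesis unfolding shift_graph_def using k(1) by metis
qed

lemma shift_graph_norm:
  assumes n: "0 \<le> n" and "shift_graph n u v"
  shows "norm v = norm u"
proof -
  from assms obtain k x where
    k: "n - 1 \<le> k" "x \<in> H k" "u = \<iota> k x" "v = \<iota> (k + 1) (\<delta> (k + 1) n x)"
    unfolding shift_graph_def by blast
  then show ?thesis
    using emb_isometry[of k] emb_isometry[of "k + 1"] delta_isometry[of n "k + 1"] n
    by (simp add: linear_isometry_on_def image_subset_iff)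
qed

lemma shift_graph_dist:
  assumes n: "0 \<le> n" and "shift_graph n u v" "shift_graph n u' v'"
  shows "dist v v' = dist u u'"
proof -
  have "shift_graph n (scale' (-1) u') (scale' (-1) v')"
    using shift_graph_scale[OF n assms(3)] .
  then have "shift_graph n (u - u') (v - v')"
    using shift_graph_add[OF n assms(2)] by fastforce
  then show ?thesis using shift_graph_norm[OF n] by (simp add: dist_norm)
qed

lemma partial_shift_unique:
  assumes n: "0 \<le> n"
    and f: "partial_shift scale' H \<delta> \<iota> n f" and g: "partial_shift scale' H \<delta> \<iota> n g"
    and x: "x \<in> tower_limit (tower H \<iota>)"
  shows "f x = g x"
proof -
  let ?L = "tower_limit (tower H \<iota>)" and ?X = "\<Union>k\<in>{n - 1..}. \<iota> k ` H k"
  have L: "?L = closure ?X" by (rule emb_closure[OF n])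
  have "f x - g x = 0"
    if "\<And>h. h \<in> {f, g} \<Longrightarrow> continuous_on ?L h"
  proof (rule continuous_constant_on_closure[where S = ?X and f = "\<lambda>x. f x - g x"])
    show "continuous_on (closure ?X) (\<lambda>x. f x - g x)"
      using that unfolding L by (intro continuous_on_diff) auto
    show "x \<in> closure ?X" using x by (simp add: L)
    show "f u - g u = 0" if "u \<in> ?X" for u
      using that f g unfolding partial_shift_def by auto
  qed
  moreover have "continuous_on ?L h" if "h \<in> {f, g}" for h
  proof -
    have h: "linear_isometry_on scale' scale' ?L ?L h"
      using that f g unfolding partial_shift_def by auto
    have sub: "u - v \<in> ?L" if "u \<in> ?L" "v \<in> ?L" for u v
    proof -
      obtain a b where a: "\<And>i::nat. a i \<in> ?X" "a \<longlonglongrightarrow> u" and b: "\<And>i::nat. b i \<in> ?X" "b \<longlonglongrightarrow> v"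
        using \<open>u \<in> ?L\<close> \<open>v \<in> ?L\<close> unfolding L closure_sequential by blast
      have *: "p - q \<in> ?X" if pq: "p \<in> ?X" "q \<in> ?X" for p q
      proof -
        obtain p' q' where "shift_graph n p p'" "shift_graph n q q'"
          using pq unfolding shift_graph_def by blast
        then have "shift_graph n (p + scale' (-1) q) (p' + scale' (-1) q')"
          by (intro shift_graph_add shift_graph_scale n)
        then show ?thesis by (auto simp: shift_graph_def)
      qed
      have "\<forall>i. a i - b i \<in> ?X" using *[OF a(1) b(1)] by blast
      moreover have "(\<lambda>i. a i - b i) \<longlonglongrightarrow> u - v" by (rule tendsto_diff[OF a(2) b(2)])
      ultimately show ?thesis unfolding L closure_sequential
        by (intro exI[of _ "\<lambda>i. a i - b i"] conjI)
    qed
    have "dist (h u) (h v) = dist u v" if "u \<in> ?L" "v \<in> ?L" for u v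
    proof -
      have "h (u - v + v) = h (u - v) + h v" "norm (h (u - v)) = norm (u - v)"
        using h sub[OF that] that(2) unfolding linear_isometry_on_def by blast+
      then show ?thesis by (simp add: dist_norm)
    qed
    then have "1-lipschitz_on ?L h" by (intro lipschitz_onI) auto
    then show ?thesis by (rule lipschitz_on_continuous_on)
  qed
  ultimately show ?thesis by simp
qed

lemma partial_shift_exists:
  assumes n: "0 \<le> n"
  shows "\<exists>f. partial_shift scale' H \<delta> \<iota> n f"
proof -
  let ?L = "tower_limit (tower H \<iota>)" and ?X = "\<Union>k\<in>{n - 1..}. \<iota> k ` H k"
  have L: "?L = closure ?X" by (rule emb_closure[OF n])
  define f where "f = (\<lambda>u. SOME v. shift_graph n u v)"
  have ex: "\<exists>v. shift_graph n u v" if "u \<in> ?X" for u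
    using that unfolding shift_graph_def by auto
  have f: "shift_graph n u (f u)" if "u \<in> ?X" for u
    unfolding f_def by (rule someI_ex[OF ex[OF that]])
  have dom: "u \<in> ?X" if "shift_graph n u v" for u v
    using that unfolding shift_graph_def by auto
  have f_eq: "f u = v" if "shift_graph n u v" for u v
    using shift_graph_dist[OF n f[OF dom[OF that]] that] by simp
  have "1-lipschitz_on ?X f"
    by (intro lipschitz_onI) (use shift_graph_dist[OF n f f] in auto)
  then have "uniformly_continuous_on ?X f" by (rule lipschitz_on_uniformly_continuous)
  then obtain g where g: "uniformly_continuous_on (closure ?X) g" "\<And>u. u \<in> ?X \<Longrightarrow> f u = g u"
    by (rule uniformly_continuous_on_extension_on_closure) (rule that)
  have cont: "continuous_on ?L g"
    using g(1) unfolding L by (rule uniformly_continuous_imp_continuous)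
  have lim: "(\<lambda>i. g (a i)) \<longlonglongrightarrow> g u" if "\<And>i::nat. a i \<in> ?X" "a \<longlonglongrightarrow> u" for a u
  proof -
    have "u \<in> ?L" unfolding L closure_sequential using that by blast
    moreover have "\<forall>i. a i \<in> ?L" using that(1) closure_subset unfolding L by fast
    ultimately show ?thesis
      using cont that(2) unfolding continuous_on_sequentially comp_def by blast
  qed
  have seq: "\<exists>a. (\<forall>i::nat. a i \<in> ?X) \<and> a \<longlonglongrightarrow> u" if "u \<in> ?L" for u
    using that unfolding L closure_sequential .
  have gX: "shift_graph n u (g u)" if "u \<in> ?X" for u using f[OF that] g(2)[OF that] by simp
  have g_eq: "g u = v" if "shift_graph n u v" for u v
    using f_eq[OF that] g(2)[OF dom[OF that]] by simp
  have sc: "continuous_on UNIV (scale' c)" for c by (rule lim.continuous_on_scale)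
  have "linear_isometry_on scale' scale' ?L ?L g"
    unfolding linear_isometry_on_def
  proof (intro conjI ballI allI)
    have "g u \<in> ?L" if u: "u \<in> ?X" for u
    proof -
      obtain k x where k: "n - 1 \<le> k" "x \<in> H k" "g u = \<iota> (k + 1) (\<delta> (k + 1) n x)"
        using gX[OF u] unfolding shift_graph_def by blast
      have "\<delta> (k + 1) n x \<in> H (k + 1)"
        using delta_isometry[of n "k + 1"] n k by (simp add: linear_isometry_on_def image_subset_iff)
      then have "g u \<in> \<iota> (k + 1) ` H (k + 1)" unfolding k(3) by (rule imageI)
      then have "g u \<in> ?X" by (rule UN_I[rotated]) (use k(1) in simp)
      then show ?thesis unfolding L by (rule subsetD[OF closure_subset])
    qed
    then have gX_sub: "g ` ?X \<subseteq> closure ?X" unfolding L by (rule image_subsetI)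
    have cont': "continuous_on (closure ?X) g"
      using g(1) by (rule uniformly_continuous_imp_continuous)
    show "g ` ?L \<subseteq> ?L"
      unfolding L by (rule image_closure_subset[OF cont' closed_closure gX_sub])
  next
    fix u v assume uv: "u \<in> ?L" "v \<in> ?L"
    obtain a where a: "\<And>i::nat. a i \<in> ?X" "a \<longlonglongrightarrow> u"
      using seq[OF uv(1)] by (elim exE conjE) (rule that, rule spec)
    obtain b where b: "\<And>i::nat. b i \<in> ?X" "b \<longlonglongrightarrow> v"
      using seq[OF uv(2)] by (elim exE conjE) (rule that, rule spec)
    have ab: "shift_graph n (a i + b i) (g (a i) + g (b i))" for i
      by (intro shift_graph_add n gX a b)
    have "(\<lambda>i. g (a i + b i)) \<longlonglongrightarrow> g (u + v)"
      by (rule lim) (use dom[OF ab] tendsto_add[OF a(2) b(2)] in simp_all)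
    moreover have "(\<lambda>i. g (a i + b i)) \<longlonglongrightarrow> g u + g v"
      using tendsto_add[OF lim[OF a] lim[OF b]] by (simp add: g_eq[OF ab])
    ultimately show "g (u + v) = g u + g v" by (rule LIMSEQ_unique)
  next
    fix c u assume u: "u \<in> ?L"
    obtain a where a: "\<And>i::nat. a i \<in> ?X" "a \<longlonglongrightarrow> u"
      using seq[OF u] by (elim exE conjE) (rule that, rule spec)
    have ca: "shift_graph n (scale' c (a i)) (scale' c (g (a i)))" for i
      by (intro shift_graph_scale n gX a)
    have sc_lim: "(\<lambda>i. scale' c (p i)) \<longlonglongrightarrow> scale' c q" if "p \<longlonglongrightarrow> q" for p :: "nat \<Rightarrow> 'b" and q
      using continuous_on_tendsto_compose[OF sc that] by simp
    have "(\<lambda>i. g (scale' c (a i))) \<longlonglongrightarrow> g (scale' c u)"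
      by (rule lim) (use dom[OF ca] sc_lim[OF a(2)] in simp_all)
    moreover have "(\<lambda>i. g (scale' c (a i))) \<longlonglongrightarrow> scale' c (g u)"
      using sc_lim[OF lim[OF a]] by (simp add: g_eq[OF ca])
    ultimately show "g (scale' c u) = scale' c (g u)" by (rule LIMSEQ_unique)
  next
    fix u assume u: "u \<in> ?L"
    obtain a where a: "\<And>i::nat. a i \<in> ?X" "a \<longlonglongrightarrow> u"
      using seq[OF u] by (elim exE conjE) (rule that, rule spec)
    have "norm (g (a i)) = norm (a i)" for i by (rule shift_graph_norm[OF n gX[OF a(1)]])
    then have "(\<lambda>i. norm (a i)) \<longlonglongrightarrow> norm (g u)"
      using tendsto_norm[OF lim[OF a]] by simp
    then show "norm (g u) = norm u" using tendsto_norm[OF a(2)] by (rule LIMSEQ_unique)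
  qed
  moreover have "\<forall>k\<ge>n - 1. \<forall>x\<in>H k. g (\<iota> k x) = \<iota> (k + 1) (\<delta> (k + 1) n x)"
    by (intro allI impI ballI g_eq) (auto simp: shift_graph_def)
  ultimately show ?thesis unfolding partial_shift_def by (intro exI conjI)
qed

end

end

theory Submission
  imports Defs
begin

text \<open>
  If \<open>\<alpha> n\<close> shifts all \<open>D k\<close> with \<open>k \<ge> n\<close>, then it maps the part of the tower orthogonal to \<open>T k\<close> to
  vectors orthogonal to \<open>T (k + 1)\<close>; hence a fixed point orthogonal to \<open>T (n - 1)\<close> is orthogonal to
  every \<open>T k\<close> and vanishes.

  Conversely, let \<open>x \<in> T n\<close>. As \<open>\<alpha> (n + 1)\<close> fixes \<open>T n\<close> and \<open>\<alpha> (n + 1) \<alpha> i = \<alpha> i \<alpha> n\<close>, the orbit of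
  \<open>x\<close> under \<open>\<alpha> n\<close> is equicorrelated: distinct members have the same inner product \<open>c = \<langle>x, \<alpha> n x\<rangle>\<close>,
  and \<open>\<langle>y, \<alpha> i v\<rangle>\<close> is the same for all \<open>v\<close> in the orbit when \<open>y \<in> T n\<close> and \<open>i \<le> n\<close>. If \<open>c = 0\<close>, then
  \<open>\<alpha> i x\<close> is orthogonal to \<open>T n\<close>, because a vector cannot have a constant nonzero inner product with
  an infinite orthogonal sequence of equal norms. For \<open>x \<in> D n\<close>, \<open>c = 0\<close> holds if
  \<open>\<alpha> n x \<in> D (n + 1)\<close>, and also under saturation at level \<open>n - 1\<close>, by a mean ergodic argument.
\<close>

section \<open>Real part of the inner product\<close>

context hilbert_space
begin

text \<open>
  The real part of the inner product, defined by polarization since \<open>'k\<close> has no real part function.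
\<close>

definition re_ip :: "'a \<Rightarrow> 'a \<Rightarrow> real"
  where "re_ip x y = ((norm (x + y))\<^sup>2 - (norm x)\<^sup>2 - (norm y)\<^sup>2) / 2"

lemma scnj_of_real: "scnj (of_real r) = (of_real r :: 'k)"
proof -
  have "scnj (1 :: 'k) = 1" using mult_scnj[of "1 :: 'k"] by simp
  then show ?thesis by (simp add: of_real_def scnj_scaleR)
qed

lemma ip_add_left: "ip (x + y) z = ip x z + ip y z"
  using ip_commute[of _ z] by (metis ip_add_right scnj_add)

lemma ip_scale_left: "ip (scale c x) y = scnj c * ip x y"
  using ip_commute[of _ y] by (metis ip_scale_right scnj_mult)

text \<open>The polarization formula does not show additivity. This identity carries bilinearity
  over from \<open>ip\<close>, because \<open>of_real\<close> is injective.\<close>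

lemma of_real_re_ip: "of_real (2 * re_ip x y) = ip x y + ip y x"
proof -
  have "of_real ((norm (x + y))\<^sup>2) = ip (x + y) (x + y)" by (simp only: ip_self)
  also have "\<dots> = ip x x + ip y y + (ip x y + ip y x)"
    by (simp add: ip_add_left ip_add_right algebra_simps)
  finally have "ip x y + ip y x = of_real ((norm (x + y))\<^sup>2 - (norm x)\<^sup>2 - (norm y)\<^sup>2)"
    by (simp add: ip_self algebra_simps)
  then show ?thesis by (simp add: re_ip_def)
qed

lemma re_ip_commute: "re_ip x y = re_ip y x"
  by (simp add: re_ip_def add.commute)

lemma re_ip_self: "re_ip x x = (norm x)\<^sup>2"
proof -
  have "norm (x + x) = 2 * norm x"
    using norm_scaleR[of 2 x] by (simp add: scaleR_2)
  then show ?thesis by (simp add: re_ip_def power_mult_distrib)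
qed

lemma re_ip_add_right: "re_ip x (y + z) = re_ip x y + re_ip x z"
proof -
  have "(of_real (2 * re_ip x (y + z)) :: 'k) = of_real (2 * re_ip x y + 2 * re_ip x z)"
    unfolding of_real_add of_real_re_ip by (simp add: ip_add_left ip_add_right)
  then show ?thesis by (simp only: of_real_eq_iff)
qed

lemma re_ip_scaleR_right: "re_ip x (r *\<^sub>R y) = r * re_ip x y"
proof -
  have "(of_real (2 * re_ip x (r *\<^sub>R y)) :: 'k) = of_real r * of_real (2 * re_ip x y)"
    unfolding of_real_re_ip
    by (simp add: ip_scale_left ip_scale_right scnj_of_real distrib_left flip: scale_of_real)
  then have "(of_real (2 * re_ip x (r *\<^sub>R y)) :: 'k) = of_real (r * (2 * re_ip x y))"
    by simp
  then show ?thesis by (simp only: of_real_eq_iff)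
qed

lemma re_ip_zero_right [simp]: "re_ip x 0 = 0"
  by (simp add: re_ip_def)

lemma re_ip_minus_right: "re_ip x (- y) = - re_ip x y"
  using re_ip_scaleR_right[of x "-1" y] by simp

lemma re_ip_diff_right: "re_ip x (y - z) = re_ip x y - re_ip x z"
  using re_ip_add_right[of x y "- z"] by (simp add: re_ip_minus_right)

lemma re_ip_sum_right: "re_ip x (\<Sum>i\<in>A. f i) = (\<Sum>i\<in>A. re_ip x (f i))"
  by (induction A rule: infinite_finite_induct) (simp_all add: re_ip_add_right)

lemma re_ip_scaleR_left: "re_ip (r *\<^sub>R x) y = r * re_ip x y"
  using re_ip_scaleR_right[of y r x] by (simp add: re_ip_commute)

lemma re_ip_sum_left: "re_ip (\<Sum>i\<in>A. f i) x = (\<Sum>i\<in>A. re_ip (f i) x)"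
  using re_ip_sum_right[of x f A] by (simp add: re_ip_commute)

lemma norm_add_square: "(norm (x + y))\<^sup>2 = (norm x)\<^sup>2 + 2 * re_ip x y + (norm y)\<^sup>2"
  by (simp add: re_ip_def field_simps)

lemma norm_diff_square: "(norm (x - y))\<^sup>2 = (norm x)\<^sup>2 - 2 * re_ip x y + (norm y)\<^sup>2"
  using norm_add_square[of x "- y"] by (simp add: re_ip_minus_right)

text \<open>Cauchy-Schwarz follows here from the triangle inequality, which the given norm
  satisfies.\<close>

lemma abs_re_ip_le: "\<bar>re_ip x y\<bar> \<le> norm x * norm y"
proof -
  have "re_ip x z \<le> norm x * norm z" for z
  proof -
    have "(norm (x + z))\<^sup>2 \<le> (norm x + norm z)\<^sup>2"
      by (intro power_mono norm_triangle_ineq) simp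
    then show ?thesis by (simp add: norm_add_square power2_sum)
  qed
  from this[of y] this[of "- y"] show ?thesis by (simp add: re_ip_minus_right)
qed

lemma tendsto_re_ip_right:
  assumes "(f \<longlongrightarrow> y) F"
  shows "((\<lambda>i. re_ip x (f i)) \<longlongrightarrow> re_ip x y) F"
proof -
  have "((\<lambda>i. norm x * norm (f i - y)) \<longlongrightarrow> 0) F"
    using tendsto_mult_right_zero[OF tendsto_norm_zero[OF LIM_zero[OF assms]]] .
  then have "((\<lambda>i. re_ip x (f i) - re_ip x y) \<longlongrightarrow> 0) F"
    by (rule Lim_null_comparison[rotated])
      (simp add: abs_re_ip_le flip: re_ip_diff_right)
  then show ?thesis by (rule LIM_zero_cancel)
qed

section \<open>Subspaces, orthogonality and projections\<close>

lemma subspace_scaleR: "subspace S \<Longrightarrow> x \<in> S \<Longrightarrow> r *\<^sub>R x \<in> S"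
  by (metis scale_of_real subspace_scale)

lemma subspace_closure:
  assumes S: "subspace S"
  shows "subspace (closure S)"
proof (rule subspaceI)
  show "0 \<in> closure S" using subspace_0[OF S] closure_subset by blast
next
  fix x y assume "x \<in> closure S" "y \<in> closure S"
  then obtain f g where "\<forall>n. f n \<in> S" "f \<longlonglongrightarrow> x" "\<forall>n. g n \<in> S" "g \<longlonglongrightarrow> y"
    unfolding closure_sequential by blast
  then show "x + y \<in> closure S"
    unfolding closure_sequential
    by (intro exI[of _ "\<lambda>n. f n + g n"]) (simp add: tendsto_add subspace_add[OF S])
next
  fix c x assume "x \<in> closure S"
  then show "scale c x \<in> closure S"
    using image_closure_subset[of S "scale c" "closure S"] continuous_on_scale
      subspace_scale[OF S] closure_subset by blast
qed

lemma ip_orthogonal_iff_re_ip: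
  assumes "subspace S"
  shows "(\<forall>y\<in>S. ip y x = 0) \<longleftrightarrow> (\<forall>y\<in>S. re_ip y x = 0)"
proof
  assume *: "\<forall>y\<in>S. ip y x = 0"
  show "\<forall>y\<in>S. re_ip y x = 0"
  proof
    fix y assume "y \<in> S"
    with * have "ip y x = 0" by blast
    moreover from this have "ip x y = 0"
      using ip_commute[of x y] scnj_of_real[of 0] by simp
    ultimately show "re_ip y x = 0" using of_real_re_ip[of y x] by simp
  qed
next
  assume *: "\<forall>y\<in>S. re_ip y x = 0"
  show "\<forall>y\<in>S. ip y x = 0"
  proof
    fix y assume "y \<in> S"
    \<comment> \<open>Replacing \<open>y\<close> by \<open>scale c y\<close>, which stays in
      \<open>S\<close>, turns the inner product into the squared norm of \<open>c\<close>, so its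
      real part loses nothing.\<close>
    define c where "c = ip y x"
    have "re_ip (scale c y) x = 0"
      using * subspace_scale[OF assms \<open>y \<in> S\<close>] by blast
    then have "ip (scale c y) x + ip x (scale c y) = 0"
      using of_real_re_ip[of "scale c y" x] by simp
    then have "2 * (c * scnj c) = 0"
      using ip_commute[of x y] by (simp add: ip_scale_left ip_scale_right c_def mult.commute)
    then show "ip y x = 0"
      by (simp add: mult_scnj c_def)
  qed
qed

text \<open>A minimizing sequence for the distance from \<open>x\<close> to \<open>S\<close> is
  Cauchy by the parallelogram law. Its limit attains the distance, and first-order optimality is
  orthogonality.\<close>

lemma orthogonal_projection_exists:
  assumes S: "subspace S" "complete S"
  shows "\<exists>p\<in>S. \<forall>y\<in>S. re_ip y (x - p) = 0"
proof -
  define d where "d = infdist x S"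
  have ne: "S \<noteq> {}" using subspace_0[OF S(1)] by blast
  have d0: "0 \<le> d" by (simp add: d_def infdist_nonneg)
  have d_le: "d\<^sup>2 \<le> (norm (x - y))\<^sup>2" if "y \<in> S" for y
    using infdist_le[OF that, of x] d0 unfolding d_def dist_norm by (rule power_mono)
  have "\<exists>p\<in>S. norm (x - p) < d + inverse (real (Suc n))" for n
  proof (rule ccontr)
    assume "\<not> ?thesis"
    then have "d + inverse (real (Suc n)) \<le> dist x p" if "p \<in> S" for p
      using that by (force simp: dist_norm)
    then have "d + inverse (real (Suc n)) \<le> infdist x S"
      unfolding infdist_notempty[OF ne] by (intro cINF_greatest ne)
    then show False by (simp add: d_def)
  qed
  then obtain p where pS: "\<And>n. p n \<in> S"
    and p: "\<And>n. norm (x - p n) < d + inverse (real (Suc n))" by metis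
  have "(\<lambda>n. d + inverse (real (Suc n))) \<longlonglongrightarrow> d + 0"
    by (intro tendsto_add tendsto_const LIMSEQ_inverse_real_of_nat)
  then have "(\<lambda>n. norm (x - p n)) \<longlonglongrightarrow> d"
    by (intro tendsto_sandwich[OF _ _ tendsto_const, of d "\<lambda>n. norm (x - p n)" sequentially
          "\<lambda>n. d + inverse (real (Suc n))"])
      (use less_imp_le[OF p] infdist_le[OF pS, of x] in
        \<open>auto intro!: always_eventually simp: d_def dist_norm simp del: of_nat_Suc\<close>)
  then have lim: "(\<lambda>n. (norm (x - p n))\<^sup>2) \<longlonglongrightarrow> d\<^sup>2" by (rule tendsto_power)
  \<comment> \<open>The midpoint of \<open>p m\<close> and \<open>p n\<close> lies in
    \<open>S\<close>, so its distance from \<open>x\<close> is at least \<open>d\<close>; this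
    bounds the sum term in the parallelogram law.\<close>
  have para: "(norm (p m - p n))\<^sup>2 \<le> 2 * ((norm (x - p m))\<^sup>2 - d\<^sup>2) + 2 * ((norm (x - p n))\<^sup>2 - d\<^sup>2)"
    for m n
  proof -
    define u v where "u = x - p m" and "v = x - p n"
    have "(1/2) *\<^sub>R (p m + p n) \<in> S"
      by (intro subspace_scaleR S(1) subspace_add pS)
    from d_le[OF this] have "d\<^sup>2 \<le> (norm ((1/2) *\<^sub>R (u + v)))\<^sup>2"
      by (simp add: u_def v_def algebra_simps flip: scaleR_2)
    then have "4 * d\<^sup>2 \<le> (norm (u + v))\<^sup>2" by (simp add: power_divide)
    moreover have "norm (p m - p n) = norm (u - v)"
      by (simp add: u_def v_def norm_minus_commute)
    ultimately show ?thesis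
      using norm_add_square[of u v] norm_diff_square[of u v] by (simp add: u_def v_def)
  qed
  have "Cauchy p"
  proof (rule metric_CauchyI)
    fix e :: real assume e: "0 < e"
    then obtain N where N: "\<And>n. n \<ge> N \<Longrightarrow> (norm (x - p n))\<^sup>2 < d\<^sup>2 + e\<^sup>2 / 4"
      using order_tendstoD(2)[OF lim, of "d\<^sup>2 + e\<^sup>2 / 4"] by (auto simp: eventually_sequentially)
    have "dist (p m) (p n) < e" if "N \<le> m" "N \<le> n" for m n
    proof -
      have "(norm (p m - p n))\<^sup>2 < e\<^sup>2"
        using para[of m n] N[OF that(1)] N[OF that(2)] by simp
      then show ?thesis using e by (simp add: dist_norm power_less_imp_less_base)
    qed
    then show "\<exists>N. \<forall>m\<ge>N. \<forall>n\<ge>N. dist (p m) (p n) < e" by blast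
  qed
  then obtain q where q: "q \<in> S" "p \<longlonglongrightarrow> q" using S(2) pS unfolding complete_def by blast
  have "(\<lambda>n. (norm (x - p n))\<^sup>2) \<longlonglongrightarrow> (norm (x - q))\<^sup>2"
    by (intro tendsto_intros q)
  then have dq: "(norm (x - q))\<^sup>2 = d\<^sup>2" using lim by (rule LIMSEQ_unique)
  have "re_ip y (x - q) = 0" if y: "y \<in> S" for y
  proof -
    define b where "b = re_ip (x - q) y"
    \<comment> \<open>This is nearly the optimal step along \<open>y\<close>; the \<open>+ 1\<close>
      keeps the denominator positive when \<open>y = 0\<close>.\<close>
    define t where "t = b / ((norm y)\<^sup>2 + 1)"
    have "q + t *\<^sub>R y \<in> S" by (intro subspace_add subspace_scaleR S(1) q y)
    from d_le[OF this] have "(norm (x - q))\<^sup>2 \<le> (norm (x - q - t *\<^sub>R y))\<^sup>2"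
      by (simp add: dq algebra_simps)
    then have "2 * (t * b) \<le> t\<^sup>2 * (norm y)\<^sup>2"
      by (simp add: norm_diff_square re_ip_scaleR_right b_def power_mult_distrib)
    also have "\<dots> \<le> t\<^sup>2 * ((norm y)\<^sup>2 + 1)" by (intro mult_left_mono) auto
    also have "\<dots> = t * b" by (simp add: t_def power2_eq_square)
    finally have "t * b \<le> 0" by linarith
    moreover have "t * b = b\<^sup>2 / ((norm y)\<^sup>2 + 1)" by (simp add: t_def power2_eq_square)
    moreover have "0 < (norm y)\<^sup>2 + 1" by (simp add: add_nonneg_pos)
    ultimately have "b\<^sup>2 \<le> 0" by (simp add: divide_le_0_iff)
    then show ?thesis by (simp add: b_def re_ip_commute)
  qed
  with q(1) show ?thesis by blast
qed

section \<open>Equicorrelated sequences\<close>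

lemma re_ip_sum_equicorrelated:
  assumes "\<And>j k. re_ip (v j) (v k) = (if j = k then s else c)" and "finite A" "finite B"
  shows "re_ip (\<Sum>j\<in>A. v j) (\<Sum>k\<in>B. v k) =
    real (card A) * real (card B) * c + real (card (A \<inter> B)) * (s - c)"
proof -
  \<comment> \<open>The Gram matrix is the constant \<open>c\<close> plus \<open>s - c\<close> on
    the diagonal.\<close>
  have "re_ip (\<Sum>j\<in>A. v j) (\<Sum>k\<in>B. v k) = (\<Sum>j\<in>A. \<Sum>k\<in>B. c + (if j = k then s - c else 0))"
    unfolding re_ip_sum_left unfolding re_ip_sum_right by (intro sum.cong) (auto simp: assms(1))
  also have "\<dots> = (\<Sum>j\<in>A. real (card B) * c + (if j \<in> B then s - c else 0))"
    using assms(3) by (simp add: sum.distrib sum.delta)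
  also have "\<dots> = real (card A) * real (card B) * c + (\<Sum>j\<in>A \<inter> B. s - c)"
    using assms(2) by (simp add: sum.distrib flip: sum.inter_restrict)
  finally show ?thesis by simp
qed

text \<open>Cauchy-Schwarz against the sum of the first \<open>N\<close> terms, whose squared norm
  is only \<open>N * s\<close>, bounds \<open>N * a\<^sup>2\<close> independently of
  \<open>N\<close>.\<close>

lemma orthogonal_sequence_constant_re_ip:
  fixes w :: "nat \<Rightarrow> 'a"
  assumes w: "\<And>j k. re_ip (w j) (w k) = (if j = k then s else 0)"
    and a: "\<And>k. re_ip y (w k) = a"
  shows "a = 0"
proof -
  have bound: "real N * a\<^sup>2 \<le> (norm y)\<^sup>2 * s" if N: "0 < N" for N
  proof -
    let ?W = "\<Sum>k<N. w k"
    have W: "(norm ?W)\<^sup>2 = real N * s"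
      using re_ip_sum_equicorrelated[OF w, of "{..<N}" "{..<N}"] by (simp add: re_ip_self)
    have "real N * a = re_ip y ?W" by (simp add: re_ip_sum_right a)
    then have "\<bar>real N * a\<bar> \<le> norm y * norm ?W" by (simp only: abs_re_ip_le)
    then have "(real N * a)\<^sup>2 \<le> (norm y * norm ?W)\<^sup>2"
      by (metis abs_ge_zero power2_abs power_mono)
    then have "(real N)\<^sup>2 * a\<^sup>2 \<le> (norm y)\<^sup>2 * (real N * s)"
      by (simp only: power_mult_distrib W)
    then have "real N * (real N * a\<^sup>2) \<le> real N * ((norm y)\<^sup>2 * s)"
      by (simp only: power2_eq_square mult_ac)
    then show ?thesis using N by simp
  qed
  show "a = 0"
  proof (rule ccontr)
    assume "a \<noteq> 0"
    then obtain N where "(norm y)\<^sup>2 * s < real N * a\<^sup>2"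
      using reals_Archimedean3[of "a\<^sup>2"] by auto
    moreover have "real N * a\<^sup>2 \<le> real (Suc N) * a\<^sup>2" by (intro mult_right_mono) auto
    ultimately show False using bound[of "Suc N"] by simp
  qed
qed

text \<open>The Gram matrix of the averages is explicit. For \<open>M \<le> N\<close> it gives the
  squared distance \<open>(s - c) / (M + 1) - (s - c) / (N + 1)\<close>, so the averages converge,
  and their squared norms tend to \<open>c\<close>.\<close>

lemma equicorrelated_averages:
  fixes v :: "nat \<Rightarrow> 'a"
  assumes v: "\<And>j k. re_ip (v j) (v k) = (if j = k then s else c)"
  obtains z where "(\<lambda>N. (1 / real (Suc N)) *\<^sub>R (\<Sum>k\<le>N. v k)) \<longlonglongrightarrow> z" "(norm z)\<^sup>2 = c"
proof -
  define A where "A N = (1 / real (Suc N)) *\<^sub>R (\<Sum>k\<le>N. v k)" for N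
  have A: "re_ip (A M) (A N) = c + (s - c) / real (Suc (max M N))" for M N
  proof -
    have "re_ip (A M) (A N) =
        (1 / real (Suc M)) * (1 / real (Suc N)) * re_ip (\<Sum>k\<le>M. v k) (\<Sum>k\<le>N. v k)"
      by (simp add: A_def re_ip_scaleR_right re_ip_scaleR_left)
    also have "re_ip (\<Sum>k\<le>M. v k) (\<Sum>k\<le>N. v k) =
        real (Suc M) * real (Suc N) * c + real (Suc (min M N)) * (s - c)"
      using re_ip_sum_equicorrelated[OF v, of "{..M}" "{..N}"]
      by (simp add: Int_atMost min_def)
    \<comment> \<open>The number of common indices cancels the smaller denominator and leaves the
      larger one.\<close>
    also have "(1 / real (Suc M)) * (1 / real (Suc N)) * \<dots> =
        c + (s - c) / real (Suc (max M N))"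
    proof -
      have "(1 / a) * (1 / b) * (a * b * c + a * d) = c + d / b"
        and "(1 / a) * (1 / b) * (a * b * c + b * d) = c + d / a"
        if "0 < a" "0 < b" for a b d :: real
        using that by (simp_all add: field_simps)
      from this[of "real (Suc M)" "real (Suc N)" "s - c"] show ?thesis
        by (cases "M \<le> N") (simp_all add: min_def max_def del: of_nat_Suc)
    qed
    finally show ?thesis .
  qed
  \<comment> \<open>The squared distance of two distinct members is
    \<open>2 * (s - c)\<close>.\<close>
  have sc: "0 \<le> s - c"
  proof -
    have "0 \<le> (norm (v 0 - v 1))\<^sup>2" by simp
    then show ?thesis using v[of 0 0] v[of 1 1] v[of 0 1]
      by (simp add: norm_diff_square re_ip_self)
  qed
  have AA: "(norm (A M - A N))\<^sup>2 \<le> (s - c) / real (Suc M)" if "M \<le> N" for M N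
  proof -
    have "(norm (A M - A N))\<^sup>2 = (s - c) / real (Suc M) - (s - c) / real (Suc N)"
      using that unfolding norm_diff_square by (simp add: A max_absorb2 flip: re_ip_self)
    also have "\<dots> \<le> (s - c) / real (Suc M)" using sc by simp
    finally show ?thesis .
  qed
  have s0: "(\<lambda>N. (s - c) / real (Suc N)) \<longlonglongrightarrow> 0"
    using tendsto_mult_right_zero[OF LIMSEQ_inverse_real_of_nat, of "s - c"]
    by (simp add: divide_inverse)
  have "Cauchy A"
  proof (rule metric_CauchyI)
    fix e :: real assume e: "0 < e"
    then obtain N where N: "\<And>n. n \<ge> N \<Longrightarrow> (s - c) / real (Suc n) < e\<^sup>2"
      using order_tendstoD(2)[OF s0, of "e\<^sup>2"] by (auto simp: eventually_sequentially)
    have "norm (A m - A n) < e" if "N \<le> m" "m \<le> n" for m n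
      using AA[of m n] N[of m] that e power_less_imp_less_base[of "norm (A m - A n)" 2 e] by simp
    then have "dist (A m) (A n) < e" if "N \<le> m" "N \<le> n" for m n
      using that by (metis dist_norm dist_commute linear)
    then show "\<exists>M. \<forall>m\<ge>M. \<forall>n\<ge>M. dist (A m) (A n) < e" by blast
  qed
  then obtain z where z: "A \<longlonglongrightarrow> z" using Cauchy_convergent convergent_def by blast
  have "(\<lambda>N. (norm (A N))\<^sup>2) \<longlonglongrightarrow> (norm z)\<^sup>2" by (intro tendsto_intros z)
  moreover have "(\<lambda>N. (norm (A N))\<^sup>2) \<longlonglongrightarrow> c + 0"
    unfolding re_ip_self[symmetric] A max.idem by (intro tendsto_intros s0)
  ultimately have "(norm z)\<^sup>2 = c" using LIMSEQ_unique by fastforce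
  with z show thesis by (intro that[of z]) (simp_all add: A_def[abs_def])
qed

end

section \<open>Towers with partial shifts\<close>

text \<open>The situation inside the limit space, with the embeddings eliminated. The last three
  assumptions live on the levels \<open>T k\<close>, where the shifts come from the maps
  \<open>\<delta>\<close>; \<open>shift_isometry\<close> concerns the whole limit space.\<close>

locale shift_tower = hilbert_space scale ip
  for scale :: "'k::rc_scalar \<Rightarrow> 'a::banach \<Rightarrow> 'a" and ip :: "'a \<Rightarrow> 'a \<Rightarrow> 'k" +
  fixes T :: "int \<Rightarrow> 'a set" and \<alpha> :: "int \<Rightarrow> 'a \<Rightarrow> 'a"
  assumes T_subspace: "-1 \<le> k \<Longrightarrow> subspace (T k)"
    and T_complete: "-1 \<le> k \<Longrightarrow> complete (T k)"
    and T_step: "-1 \<le> k \<Longrightarrow> T k \<subseteq> T (k + 1)"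
    and shift_isometry:
      "0 \<le> n \<Longrightarrow> linear_isometry_on scale scale (tower_limit T) (tower_limit T) (\<alpha> n)"
    and shift_fixes: "0 \<le> n \<Longrightarrow> x \<in> T (n - 1) \<Longrightarrow> \<alpha> n x = x"
    and shift_mem: "0 \<le> n \<Longrightarrow> n - 1 \<le> k \<Longrightarrow> x \<in> T k \<Longrightarrow> \<alpha> n x \<in> T (k + 1)"
    and shift_commute:
      "0 \<le> i \<Longrightarrow> i < j \<Longrightarrow> j - 2 \<le> k \<Longrightarrow> x \<in> T k \<Longrightarrow> \<alpha> j (\<alpha> i x) = \<alpha> i (\<alpha> (j - 1) x)"
begin

abbreviation L :: "'a set" where "L \<equiv> tower_limit T"

lemma T_mono: "k \<le> l \<Longrightarrow> -1 \<le> k \<Longrightarrow> T k \<subseteq> T l"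
proof (induction l rule: int_ge_induct)
  case (step l)
  then show ?case using T_step[of l] by force
qed simp

lemma T_subset_L: "-1 \<le> k \<Longrightarrow> T k \<subseteq> L"
  unfolding tower_limit_def by (rule order_trans[OF _ closure_subset]) auto

text \<open>Because the tower increases, the approximating level can be taken above any prescribed
  \<open>k\<close>.\<close>

lemma L_approx:
  assumes "x \<in> L" "0 < e"
  obtains m t where "k \<le> m" "-1 \<le> m" "t \<in> T m" "norm (t - x) < e"
proof -
  from assms obtain t l where t: "-1 \<le> l" "t \<in> T l" "norm (t - x) < e"
    unfolding tower_limit_def closure_approachable dist_norm by auto
  have "t \<in> T (max k l)" using T_mono[of l "max k l"] t by auto
  with t show thesis by (intro that[of "max k l"]) auto
qed

lemma L_subspace: "subspace L"
  unfolding tower_limit_def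
proof (intro subspace_closure subspaceI)
  show "0 \<in> (\<Union>k\<in>{-1..}. T k)" using subspace_0[OF T_subspace[of "-1"]] by force
next
  fix x y assume "x \<in> (\<Union>k\<in>{-1..}. T k)" "y \<in> (\<Union>k\<in>{-1..}. T k)"
  then obtain k l where kl: "-1 \<le> k" "x \<in> T k" "-1 \<le> l" "y \<in> T l" by auto
  then have "x \<in> T (max k l)" "y \<in> T (max k l)"
    using T_mono[of k "max k l"] T_mono[of l "max k l"] by auto
  then have "x + y \<in> T (max k l)" using kl T_subspace[of "max k l"] by (intro subspace_add) auto
  with kl show "x + y \<in> (\<Union>k\<in>{-1..}. T k)" by (intro UN_I[of "max k l"]) auto
next
  fix c x assume "x \<in> (\<Union>k\<in>{-1..}. T k)"
  then show "scale c x \<in> (\<Union>k\<in>{-1..}. T k)" using T_subspace subspace_scale by fastforce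
qed

context
  fixes n :: int
  assumes n: "0 \<le> n"
begin

lemma shift_L: "x \<in> L \<Longrightarrow> \<alpha> n x \<in> L"
  and shift_add: "x \<in> L \<Longrightarrow> y \<in> L \<Longrightarrow> \<alpha> n (x + y) = \<alpha> n x + \<alpha> n y"
  and shift_scale: "x \<in> L \<Longrightarrow> \<alpha> n (scale c x) = scale c (\<alpha> n x)"
  and shift_norm: "x \<in> L \<Longrightarrow> norm (\<alpha> n x) = norm x"
  using shift_isometry[OF n] by (auto simp: linear_isometry_on_def)

lemma shift_scaleR: "x \<in> L \<Longrightarrow> \<alpha> n (r *\<^sub>R x) = r *\<^sub>R \<alpha> n x"
  by (metis scale_of_real shift_scale)

lemma shift_diff: "x \<in> L \<Longrightarrow> y \<in> L \<Longrightarrow> \<alpha> n (x - y) = \<alpha> n x - \<alpha> n y"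
  using shift_add[of "x - y" y] subspace_diff[OF L_subspace] by simp

lemma shift_sum: "(\<And>i. i \<in> A \<Longrightarrow> f i \<in> L) \<Longrightarrow> \<alpha> n (\<Sum>i\<in>A. f i) = (\<Sum>i\<in>A. \<alpha> n (f i))"
proof (induction A rule: infinite_finite_induct)
  case (insert a A)
  then show ?case using shift_add[of "f a" "sum f A"] subspace_sum[OF L_subspace, of A f] by auto
qed (use shift_scaleR[of 0 0] subspace_0[OF L_subspace] in auto)

lemma shift_re_ip: "x \<in> L \<Longrightarrow> y \<in> L \<Longrightarrow> re_ip (\<alpha> n x) (\<alpha> n y) = re_ip x y"
  using shift_norm[of "x + y"] subspace_add[OF L_subspace, of x y]
  by (simp add: re_ip_def shift_add shift_norm)

end

section \<open>Orbits of a shift\<close>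

lemma funpow_shift_mem:
  assumes "0 \<le> n" "n - 1 \<le> k" "x \<in> T k"
  shows "(\<alpha> n ^^ m) x \<in> T (k + int m)"
proof (induction m)
  case (Suc m)
  then show ?case using shift_mem[of n "k + int m"] assms by (simp add: add_ac)
qed (use assms in simp)

lemma orbit_L:
  assumes "0 \<le> n" "x \<in> T n"
  shows "(\<alpha> n ^^ m) x \<in> L"
  using funpow_shift_mem[of n n x m] T_subset_L[of "n + int m"] assms by auto

text \<open>The isometry \<open>\<alpha> (n + 1)\<close> fixes \<open>y\<close> and sends
  \<open>\<alpha> i v\<close> to \<open>\<alpha> i (\<alpha> n v)\<close>, so one step along the
  orbit changes nothing.\<close>

lemma re_ip_shift_orbit:
  assumes n: "0 \<le> n" and i: "0 \<le> i" "i \<le> n" and x: "x \<in> T n" and y: "y \<in> T n"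
  shows "re_ip y (\<alpha> i ((\<alpha> n ^^ m) x)) = re_ip y (\<alpha> i x)"
proof (induction m)
  case (Suc m)
  let ?v = "(\<alpha> n ^^ m) x"
  have v: "?v \<in> T (n + int m)" "?v \<in> L"
    using funpow_shift_mem[of n n x m] orbit_L[of n x m] n x by auto
  have "re_ip y (\<alpha> i ((\<alpha> n ^^ Suc m) x)) = re_ip (\<alpha> (n + 1) y) (\<alpha> (n + 1) (\<alpha> i ?v))"
    using shift_commute[of i "n + 1" "n + int m" ?v] shift_fixes[of "n + 1" y] n i v y by simp
  also have "\<dots> = re_ip y (\<alpha> i ?v)"
    using n i v y T_subset_L[of n] by (intro shift_re_ip shift_L) auto
  finally show ?case using Suc by simp
qed simp

text \<open>Common isometric factors cancel, leaving \<open>x\<close> against a positive power of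
  \<open>\<alpha> n\<close>. The case \<open>i = n\<close>, \<open>y = x\<close> of
  \<open>re_ip_shift_orbit\<close> then removes all but one factor.\<close>

lemma re_ip_orbit:
  assumes n: "0 \<le> n" and x: "x \<in> T n"
  shows "re_ip ((\<alpha> n ^^ j) x) ((\<alpha> n ^^ k) x) = (if j = k then (norm x)\<^sup>2 else re_ip x (\<alpha> n x))"
proof -
  have *: "re_ip ((\<alpha> n ^^ j) y) ((\<alpha> n ^^ j) z) = re_ip y z" if "y \<in> L" "z \<in> L" for j y z
  proof (induction j)
    case (Suc j)
    have "(\<alpha> n ^^ j) w \<in> L" if "w \<in> L" for w
      using that by (induction j) (simp_all add: shift_L[OF n])
    with Suc that show ?case by (simp add: shift_re_ip[OF n])
  qed simp
  have less: "re_ip ((\<alpha> n ^^ j) x) ((\<alpha> n ^^ k) x) = re_ip x (\<alpha> n x)" if "j < k" for j k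
  proof -
    obtain m where k: "k = j + Suc m" using less_imp_Suc_add[OF \<open>j < k\<close>] by auto
    have "re_ip ((\<alpha> n ^^ j) x) ((\<alpha> n ^^ k) x) = re_ip x ((\<alpha> n ^^ Suc m) x)"
      unfolding k funpow_add comp_def 
      by (rule *) (use orbit_L[OF n x, of 0] orbit_L[OF n x, of "Suc m"] in simp_all)
    then show ?thesis using re_ip_shift_orbit[of n n x x m] n x by simp
  qed
  show ?thesis
  proof (cases j k rule: linorder_cases)
    case equal
    then show ?thesis using *[of x x j] orbit_L[OF n x, of 0] by (simp add: re_ip_self)
  qed (use less[of j k] less[of k j] re_ip_commute in auto)
qed

text \<open>By \<open>x0\<close> the orbit of \<open>x\<close> is orthogonal, and
  \<open>\<alpha> i\<close> keeps it so; \<open>y\<close> has the same inner product with all the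
  images.\<close>

lemma shift_orthogonal:
  assumes n: "0 \<le> n" and i: "0 \<le> i" "i \<le> n" and x: "x \<in> T n" and x0: "re_ip x (\<alpha> n x) = 0"
    and y: "y \<in> T n"
  shows "re_ip y (\<alpha> i x) = 0"
proof (rule orthogonal_sequence_constant_re_ip)
  show "re_ip (\<alpha> i ((\<alpha> n ^^ j) x)) (\<alpha> i ((\<alpha> n ^^ k) x)) = (if j = k then (norm x)\<^sup>2 else 0)" for j k
    using shift_re_ip[OF i(1) orbit_L[OF n x] orbit_L[OF n x]] re_ip_orbit[OF n x] x0 by simp
  show "re_ip y (\<alpha> i ((\<alpha> n ^^ k) x)) = re_ip y (\<alpha> i x)" for k
    by (rule re_ip_shift_orbit[OF n i x y])
qed

text \<open>
  Mean ergodic argument: the averages of the orbit of \<open>x\<close> converge to a fixed point \<open>z\<close>, which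
  saturation places in \<open>T (n - 1)\<close>, and \<open>x\<close> is orthogonal to that space.
\<close>

lemma saturated_re_ip_shift:
  assumes n: "0 \<le> n" and sat: "saturated_at T \<alpha> (n - 1)"
    and x: "x \<in> T n" and x_orth: "\<And>y. y \<in> T (n - 1) \<Longrightarrow> re_ip y x = 0"
  shows "re_ip x (\<alpha> n x) = 0"
proof -
  define v where "v k = (\<alpha> n ^^ k) x" for k
  define A where "A N = (1 / real (Suc N)) *\<^sub>R (\<Sum>k\<le>N. v k)" for N
  have vL: "v k \<in> L" for k by (simp add: v_def orbit_L[OF n x])
  have sumL: "(\<Sum>k\<le>N. v k) \<in> L" for N by (intro subspace_sum L_subspace vL)
  have AL: "A N \<in> L" for N unfolding A_def by (intro subspace_scaleR L_subspace sumL)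
  \<comment> \<open>The squared norm of \<open>z\<close> is the inner product in question, so the
    goal becomes \<open>z = 0\<close>.\<close>
  obtain z where z: "A \<longlonglongrightarrow> z" "(norm z)\<^sup>2 = re_ip x (\<alpha> n x)"
    using equicorrelated_averages[OF re_ip_orbit[OF n x]] unfolding A_def v_def by blast
  have zL: "z \<in> L"
    using z(1) AL closed_sequentially[of L A z] by (simp add: tower_limit_def)
  have "(\<lambda>N. \<alpha> n (A N) - A N) \<longlonglongrightarrow> 0"
  proof (rule Lim_null_comparison[where g = "\<lambda>N. 2 * norm x * inverse (real (Suc N))"])
    \<comment> \<open>The shift raises every index of the orbit sum by one, so the difference
      telescopes to its end terms.\<close>
    have "\<alpha> n (A N) - A N = (1 / real (Suc N)) *\<^sub>R (v (Suc N) - v 0)" for N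
    proof -
      have "\<alpha> n (\<Sum>k\<le>N. v k) = (\<Sum>k\<le>N. v (Suc k))"
        using shift_sum[OF n, of "{..N}" v] vL by (simp add: v_def)
      then have "\<alpha> n (\<Sum>k\<le>N. v k) - (\<Sum>k\<le>N. v k) = v (Suc N) - v 0"
        using sum_Suc_diff[of 0 N v] by (simp add: atLeast0AtMost flip: sum_subtractf)
      then show ?thesis
        using sumL by (simp add: A_def shift_scaleR[OF n] flip: scaleR_diff_right)
    qed
    moreover have "norm (v k) = norm x" for k
      using re_ip_orbit[OF n x, of k k] by (simp add: v_def re_ip_self)
    ultimately have "norm (\<alpha> n (A N) - A N) \<le> 2 * norm x * inverse (real (Suc N))" for N
      using norm_triangle_ineq4[of "v (Suc N)" "v 0"]
      by (simp add: divide_inverse mult.commute mult_left_mono del: of_nat_Suc)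
    then show "\<forall>\<^sub>F N in sequentially. norm (\<alpha> n (A N) - A N) \<le> 2 * norm x * inverse (real (Suc N))"
      by (rule always_eventually[OF allI])
    show "(\<lambda>N. 2 * norm x * inverse (real (Suc N))) \<longlonglongrightarrow> 0"
      by (intro tendsto_mult_right_zero LIMSEQ_inverse_real_of_nat)
  qed
  then have "(\<lambda>N. \<alpha> n (A N) - A N + A N) \<longlonglongrightarrow> 0 + z" by (intro tendsto_add z(1))
  then have "(\<lambda>N. \<alpha> n (A N)) \<longlonglongrightarrow> z" by simp
  moreover have "(\<lambda>N. \<alpha> n (A N)) \<longlonglongrightarrow> \<alpha> n z"
  proof (rule LIM_zero_cancel, rule tendsto_norm_zero_cancel)
    have "norm (\<alpha> n (A N) - \<alpha> n z) = norm (A N - z)" for N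
      using shift_norm[OF n, of "A N - z"] shift_diff[OF n AL zL] subspace_diff[OF L_subspace AL zL]
      by simp
    then show "(\<lambda>N. norm (\<alpha> n (A N) - \<alpha> n z)) \<longlonglongrightarrow> 0"
      using tendsto_norm_zero[OF LIM_zero[OF z(1)]] by simp
  qed
  ultimately have "\<alpha> n z = z" using LIMSEQ_unique by blast
  then have zT: "z \<in> T (n - 1)" using sat zL unfolding saturated_at_def by auto
  \<comment> \<open>As \<open>z\<close> is fixed by the isometry, its inner product with the orbit
    is constant, and it vanishes at \<open>v 0 = x\<close>. Thus \<open>z\<close> is orthogonal to
    all averages, hence to its own limit.\<close>
  have "re_ip z (v k) = 0" for k
  proof (induction k)
    case 0
    then show ?case using x_orth[OF zT] by (simp add: v_def)
  next
    case (Suc k)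
    have "re_ip z (v (Suc k)) = re_ip (\<alpha> n z) (\<alpha> n (v k))"
      using \<open>\<alpha> n z = z\<close> by (simp add: v_def)
    then show ?case using Suc by (simp add: shift_re_ip[OF n zL vL])
  qed
  then have "re_ip z (A N) = 0" for N by (simp add: A_def re_ip_scaleR_right re_ip_sum_right)
  then have "re_ip z z = 0"
    using tendsto_re_ip_right[OF z(1), of z] by (simp add: LIMSEQ_const_iff)
  then show ?thesis using z(2) by (simp add: re_ip_self)
qed

section \<open>Innovation spaces and saturation\<close>

abbreviation D :: "int \<Rightarrow> 'a set" where "D \<equiv> innovation ip T"

lemma mem_D_iff:
  assumes "0 \<le> n"
  shows "x \<in> D n \<longleftrightarrow> x \<in> T n \<and> (\<forall>y\<in>T (n - 1). re_ip y x = 0)"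
  using ip_orthogonal_iff_re_ip[OF T_subspace[of "n - 1"], of x] assms
  by (simp add: innovation_def)

text \<open>As \<open>x\<close> itself lies in \<open>T n\<close>, the top index already yields
  \<open>re_ip x (\<alpha> n x) = 0\<close>, the condition under which
  \<open>shift_orthogonal\<close> serves every \<open>i \<le> n\<close>.\<close>

lemma shift_D_subset_of_top:
  assumes n: "0 \<le> n" and i: "0 \<le> i" "i \<le> n" and top: "\<alpha> n ` D n \<subseteq> D (n + 1)"
  shows "\<alpha> i ` D n \<subseteq> D (n + 1)"
proof (rule image_subsetI)
  fix x assume xD: "x \<in> D n"
  then have x: "x \<in> T n" using mem_D_iff[OF n] by blast
  have "\<alpha> n x \<in> D (n + 1)" using top xD by blast
  then have "re_ip x (\<alpha> n x) = 0" using mem_D_iff[of "n + 1"] n x by simp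
  then show "\<alpha> i x \<in> D (n + 1)"
    using mem_D_iff[of "n + 1"] shift_orthogonal[OF n i x] shift_mem[OF i(1) _ x] n i by simp
qed

lemma shift_D_subset_of_saturated:
  assumes n: "0 \<le> n" and i: "0 \<le> i" "i \<le> n" and sat: "saturated_at T \<alpha> (n - 1)"
  shows "\<alpha> i ` D n \<subseteq> D (n + 1)"
proof (rule image_subsetI)
  fix x assume "x \<in> D n"
  then have x: "x \<in> T n" "\<And>y. y \<in> T (n - 1) \<Longrightarrow> re_ip y x = 0" using mem_D_iff[OF n] by blast+
  show "\<alpha> i x \<in> D (n + 1)"
    using mem_D_iff[of "n + 1"] shift_orthogonal[OF n i x(1) saturated_re_ip_shift[OF n sat x]]
      shift_mem[OF i(1) _ x(1)] n i by simp
qed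

text \<open>Induction on the level of \<open>z\<close>: its top innovation component is shifted by
  \<open>D\<close>, and the remainder one level lower is still orthogonal to
  \<open>T k\<close>.\<close>

lemma shift_orthogonal_of_D:
  assumes n: "0 \<le> n" and D: "\<And>k. n \<le> k \<Longrightarrow> \<alpha> n ` D k \<subseteq> D (k + 1)"
    and k: "n - 1 \<le> k" and "k \<le> m"
    and "z \<in> T m" "\<And>w. w \<in> T k \<Longrightarrow> re_ip w z = 0" "w \<in> T (k + 1)"
  shows "re_ip w (\<alpha> n z) = 0"
  using assms(4-)
proof (induction m arbitrary: z rule: int_ge_induct)
  case base
  \<comment> \<open>At \<open>m = k\<close> the vector lies in the space to which it is
    orthogonal.\<close>
  then have "z = 0" using re_ip_self[of z] by fastforce
  moreover have "\<alpha> n 0 = 0" using shift_scaleR[OF n, of 0 0] subspace_0[OF L_subspace] by simp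
  ultimately show ?case by simp
next
  case (step m)
  \<comment> \<open>The component split off lives at level \<open>m + 1\<close>, so \<open>D\<close>
    applies even when \<open>k = n - 1\<close>.\<close>
  have m: "-1 \<le> m" "n \<le> m + 1" using n k step.hyps by auto
  obtain p where p: "p \<in> T m" "\<And>y. y \<in> T m \<Longrightarrow> re_ip y (z - p) = 0"
    using orthogonal_projection_exists[OF T_subspace[OF m(1)] T_complete[OF m(1)]] by blast
  have T: "T k \<subseteq> T m" "T (k + 1) \<subseteq> T (m + 1)" "T m \<subseteq> T (m + 1)" "T m \<subseteq> L" "T (m + 1) \<subseteq> L"
    using T_mono[of k m] T_mono[of "k + 1" "m + 1"] T_step[of m] T_subset_L[of m]
      T_subset_L[of "m + 1"] n k m step.hyps by auto
  have d: "z - p \<in> T (m + 1)"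
    using step.prems(1) p(1) T(3) T_subspace[of "m + 1"] m by (intro subspace_diff) auto
  have "z - p \<in> D (m + 1)" using mem_D_iff[of "m + 1"] p(2) d n m by simp
  then have "\<alpha> n (z - p) \<in> D (m + 1 + 1)" using D[OF m(2)] by blast
  then have "re_ip w (\<alpha> n (z - p)) = 0"
    using mem_D_iff[of "m + 1 + 1" "\<alpha> n (z - p)"] n m subsetD[OF T(2) step.prems(3)]
    by (simp add: add.commute)
  moreover have "re_ip w (\<alpha> n p) = 0"
  proof (rule step.IH[OF p(1) _ step.prems(3)])
    fix u assume "u \<in> T k"
    then show "re_ip u p = 0"
      using step.prems(2)[of u] p(2)[of u] T(1) by (auto simp: re_ip_diff_right)
  qed
  moreover have "\<alpha> n z = \<alpha> n (z - p) + \<alpha> n p"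
    using shift_add[OF n subsetD[OF T(5) d] subsetD[OF T(4) p(1)]] by simp
  ultimately show ?case by (simp add: re_ip_add_right)
qed

text \<open>A fixed point equals its own shift. It is approximated by vectors \<open>z\<close> of
  the tower orthogonal to \<open>T k\<close>, and their shifts are orthogonal to
  \<open>T (k + 1)\<close>.\<close>

lemma fixed_orthogonal_step:
  assumes n: "0 \<le> n" and D: "\<And>k. n \<le> k \<Longrightarrow> \<alpha> n ` D k \<subseteq> D (k + 1)"
    and k: "n - 1 \<le> k" and y: "y \<in> L" "\<alpha> n y = y" "\<And>w. w \<in> T k \<Longrightarrow> re_ip w y = 0"
    and w: "w \<in> T (k + 1)"
  shows "re_ip w y = 0"
proof (rule ccontr)
  assume ne: "re_ip w y \<noteq> 0"
  then have w0: "0 < norm w" by (auto simp: re_ip_commute[of 0])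
  \<comment> \<open>The approximation and its correction by \<open>q\<close> cost less than
    \<open>e\<close> each; \<open>2 * e * norm w\<close> is exactly the value to be
    contradicted.\<close>
  define e where "e = \<bar>re_ip w y\<bar> / (2 * norm w)"
  have "0 < e" using ne w0 by (simp add: e_def)
  then obtain m t where m: "k \<le> m" "-1 \<le> m" and t: "t \<in> T m" "norm (t - y) < e"
    by (rule L_approx[OF y(1)])
  have k': "-1 \<le> k" using n k by simp
  obtain q where q: "q \<in> T k" "\<And>u. u \<in> T k \<Longrightarrow> re_ip u (t - q) = 0"
    using orthogonal_projection_exists[OF T_subspace[OF k'] T_complete[OF k']] by blast
  \<comment> \<open>Since \<open>y\<close> is orthogonal to \<open>T k\<close>, \<open>q\<close> is
    also the projection of \<open>t - y\<close>.\<close>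
  have "norm q * norm q = re_ip q (t - y)"
    using q y(3)[OF q(1)] re_ip_self[of q] q(2)[OF q(1)] by (simp add: re_ip_diff_right power2_eq_square)
  also have "\<dots> \<le> norm q * norm (t - y)" using abs_re_ip_le[of q "t - y"] by simp
  finally have q_le: "norm q \<le> norm (t - y)"
    by (cases "q = 0") simp_all
  define z where "z = t - q"
  have zT: "z \<in> T m"
    unfolding z_def using T_mono[OF m(1) k'] q(1) t(1) T_subspace[OF m(2)] by (intro subspace_diff) auto
  have zL: "z \<in> L" using zT T_subset_L[OF m(2)] by blast
  have yz: "norm (y - z) < 2 * e"
    using norm_triangle_ineq[of "y - t" q] q_le t(2) norm_minus_commute[of t y]
    by (simp add: z_def algebra_simps)
  have "re_ip w (\<alpha> n z) = 0"
    using shift_orthogonal_of_D[OF n D k m(1) zT _ w] q(2) by (simp add: z_def)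
  then have "re_ip w y = re_ip w (\<alpha> n (y - z))"
    by (simp add: shift_diff[OF n y(1) zL] y(2) re_ip_diff_right)
  then have "\<bar>re_ip w y\<bar> \<le> norm w * norm (\<alpha> n (y - z))" by (simp only: abs_re_ip_le)
  also have "\<dots> = norm w * norm (y - z)"
    using shift_norm[OF n] subspace_diff[OF L_subspace y(1) zL] by simp
  also have "\<dots> < norm w * (2 * e)" using yz w0 by simp
  also have "\<dots> = \<bar>re_ip w y\<bar>" using w0 by (simp add: e_def)
  finally show False by simp
qed

text \<open>Removing the projection onto \<open>T (n - 1)\<close>, which is itself fixed, leaves a
  fixed point \<open>y\<close> to which \<open>fixed_orthogonal_step\<close> applies at every
  level.\<close>

lemma saturated_at_of_shift_D:
  assumes n: "0 \<le> n" and D: "\<And>k. n \<le> k \<Longrightarrow> \<alpha> n ` D k \<subseteq> D (k + 1)"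
  shows "saturated_at T \<alpha> (n - 1)"
proof -
  have n': "-1 \<le> n - 1" using n by simp
  have "x \<in> T (n - 1)" if x: "x \<in> L" "\<alpha> n x = x" for x
  proof -
    obtain p where p: "p \<in> T (n - 1)" "\<And>y. y \<in> T (n - 1) \<Longrightarrow> re_ip y (x - p) = 0"
      using orthogonal_projection_exists[OF T_subspace[OF n'] T_complete[OF n']] by blast
    define y where "y = x - p"
    have pL: "p \<in> L" using p(1) T_subset_L[OF n'] by blast
    have yL: "y \<in> L" unfolding y_def by (intro subspace_diff L_subspace x pL)
    have fix_y: "\<alpha> n y = y"
      using shift_fixes[OF n p(1)] by (simp add: y_def shift_diff[OF n x(1) pL] x(2))
    have orth: "\<forall>w\<in>T k. re_ip w y = 0" if "n - 1 \<le> k" for k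
      using that
    proof (induction k rule: int_ge_induct)
      case base
      then show ?case using p(2) by (simp add: y_def)
    next
      case (step k)
      then show ?case using fixed_orthogonal_step[OF n D _ yL fix_y] by blast
    qed
    \<comment> \<open>By Pythagoras no vector \<open>t\<close> of the tower is closer to
      \<open>y\<close> than 0 is, against density.\<close>
    have "y = 0"
    proof (rule ccontr)
      assume y0: "y \<noteq> 0"
      obtain m t where t: "n - 1 \<le> m" "t \<in> T m" "norm (t - y) < norm y"
        using L_approx[OF yL, of "norm y" "n - 1"] y0 by (metis zero_less_norm_iff)
      have "(norm (t - y))\<^sup>2 = (norm t)\<^sup>2 + (norm y)\<^sup>2"
        using orth[OF t(1)] t(2) by (simp add: norm_diff_square)
      moreover have "(norm (t - y))\<^sup>2 < (norm y)\<^sup>2"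
        using t(3) by (intro power_strict_mono) auto
      ultimately show False using zero_le_power2[of "norm t"] by linarith
    qed
    then show ?thesis using p(1) by (simp add: y_def)
  qed
  then show ?thesis
    unfolding saturated_at_def using T_subset_L[OF n'] shift_fixes[OF n] by auto
qed

end

section \<open>The tower of a semi-cosimplicial Hilbert space\<close>

lemma (in semi_cosimplicial_tower) shift_tower_tower:
  assumes shifts: "\<And>n. 0 \<le> n \<Longrightarrow> partial_shift scale' H \<delta> \<iota> n (\<alpha> n)"
  shows "shift_tower scale' ip' (tower H \<iota>) \<alpha>"
proof
  have delta_mem: "\<delta> n i x \<in> H n" if "0 \<le> i" "i \<le> n" "x \<in> H (n - 1)" for n i x
    using delta_isometry[OF that(1,2)] that(3) by (auto simp: linear_isometry_on_def)
  have shift_emb: "\<alpha> n (\<iota> k x) = \<iota> (k + 1) (\<delta> (k + 1) n x)" if "0 \<le> n" "n - 1 \<le> k" "x \<in> H k" for n k x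
    using shifts[OF that(1)] that unfolding partial_shift_def by blast
  fix k :: int
  {
    assume k: "-1 \<le> k"
    have emb_add: "\<iota> k (x + y) = \<iota> k x + \<iota> k y" if "x \<in> H k" "y \<in> H k" for x y
      using emb_isometry[OF k] that by (simp add: linear_isometry_on_def)
    have emb_scale: "\<iota> k (scale c x) = scale' c (\<iota> k x)" if "x \<in> H k" for c x
      using emb_isometry[OF k] that by (simp add: linear_isometry_on_def)
    have emb_norm: "norm (\<iota> k x) = norm x" if "x \<in> H k" for x
      using emb_isometry[OF k] that by (simp add: linear_isometry_on_def)
    show "lim.subspace (tower H \<iota> k)"
      unfolding tower_def
    proof (rule lim.subspaceI)
      have "\<iota> k 0 = 0" using emb_norm[of 0] subspace_0[OF H_subspace[OF k]] by simp
      then show "0 \<in> \<iota> k ` H k" using subspace_0[OF H_subspace[OF k]] by (metis imageI)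
    next
      fix u v assume "u \<in> \<iota> k ` H k" "v \<in> \<iota> k ` H k"
      then show "u + v \<in> \<iota> k ` H k"
        using subspace_add[OF H_subspace[OF k]] by (auto simp flip: emb_add)
    next
      fix c u assume "u \<in> \<iota> k ` H k"
      then show "scale' c u \<in> \<iota> k ` H k"
        using subspace_scale[OF H_subspace[OF k]] by (auto simp flip: emb_scale)
    qed
    have emb_dist: "dist (\<iota> k x) (\<iota> k y) = dist x y" if "x \<in> H k" "y \<in> H k" for x y
    proof -
      have "x - y \<in> H k" using that by (rule subspace_diff[OF H_subspace[OF k]])
      then show ?thesis
        using emb_add[of "x - y" y] emb_norm[of "x - y"] that by (simp add: dist_norm)
    qed
    \<comment> \<open>A Cauchy sequence in the image pulls back along the isometry to the closed,
      hence complete, space \<open>H k\<close>.\<close>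
    show "complete (tower H \<iota> k)"
      unfolding complete_def tower_def
    proof (intro allI impI)
      fix f :: "nat \<Rightarrow> 'b" assume "(\<forall>i. f i \<in> \<iota> k ` H k) \<and> Cauchy f"
      then have "\<forall>i. \<exists>a. a \<in> H k \<and> f i = \<iota> k a" and "Cauchy f" by blast+
      then obtain g where g: "\<And>i. g i \<in> H k" "\<And>i. f i = \<iota> k (g i)" "Cauchy f"
        unfolding choice_iff by blast
      have "Cauchy g" using g(3) by (simp add: Cauchy_def g(2) emb_dist[OF g(1) g(1)])
      then obtain x where x: "x \<in> H k" "g \<longlonglongrightarrow> x"
        using completeE[OF H_closed[OF k, folded complete_eq_closed], of g] g(1) by blast
      have "f \<longlonglongrightarrow> \<iota> k x"
        using x(2) emb_dist[OF g(1) x(1)] unfolding tendsto_dist_iff[of f] tendsto_dist_iff[of g] g(2)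
        by (simp only:)
      then show "\<exists>l\<in>\<iota> k ` H k. f \<longlonglongrightarrow> l" using imageI[OF x(1), of "\<iota> k"] by (rule bexI)
    qed
    show "tower H \<iota> k \<subseteq> tower H \<iota> (k + 1)"
      unfolding tower_def
    proof (rule image_subsetI)
      fix x assume "x \<in> H k"
      then show "\<iota> k x \<in> \<iota> (k + 1) ` H (k + 1)"
        using emb_top[of "k + 1" x] delta_mem[of "k + 1" "k + 1" x] k
        by (intro image_eqI[of _ _ "\<delta> (k + 1) (k + 1) x"]) simp_all
    qed
  next
    fix n x assume n: "0 \<le> n" "n - 1 \<le> k" and "x \<in> tower H \<iota> k"
    then obtain a where a: "a \<in> H k" "x = \<iota> k a" by (auto simp: tower_def)
    then show "\<alpha> n x \<in> tower H \<iota> (k + 1)"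
      using shift_emb[OF n a(1)] delta_mem[of n "k + 1" a] n by (auto simp: tower_def)
  next
    fix i j x assume ij: "0 \<le> i" "i < j" "j - 2 \<le> k" and "x \<in> tower H \<iota> k"
    then obtain a where a: "a \<in> H k" "x = \<iota> k a" by (auto simp: tower_def)
    have mem: "\<delta> (k + 1) l a \<in> H (k + 1)" if "0 \<le> l" "l \<le> k + 1" for l
      using delta_mem[of l "k + 1" a] that a(1) by simp
    have twice: "\<alpha> l' (\<alpha> l x) = \<iota> (k + 2) (\<delta> (k + 2) l' (\<delta> (k + 1) l a))"
      if "0 \<le> l" "l \<le> k + 1" "0 \<le> l'" "l' \<le> k + 2" for l l'
    proof -
      have "\<alpha> l x = \<iota> (k + 1) (\<delta> (k + 1) l a)" unfolding a(2) using that a(1) by (intro shift_emb) auto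
      moreover have "\<alpha> l' (\<iota> (k + 1) (\<delta> (k + 1) l a)) =
          \<iota> (k + 1 + 1) (\<delta> (k + 1 + 1) l' (\<delta> (k + 1) l a))"
        using that mem by (intro shift_emb) auto
      moreover have "k + 1 + 1 = k + 2" by simp
      ultimately show ?thesis by (simp only:)
    qed
    \<comment> \<open>The hypothesis \<open>j - 2 \<le> k\<close> is the index bound of the identity
      with target \<open>H (k + 2)\<close>.\<close>
    have "\<delta> (k + 2) j (\<delta> (k + 2 - 1) i a) = \<delta> (k + 2) i (\<delta> (k + 2 - 1) (j - 1) a)"
      using ij a(1) by (intro cosimplicial_identity) auto
    moreover have "k + 2 - 1 = k + 1" by simp
    ultimately have "\<delta> (k + 2) j (\<delta> (k + 1) i a) = \<delta> (k + 2) i (\<delta> (k + 1) (j - 1) a)"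
      by (simp only:)
    then show "\<alpha> j (\<alpha> i x) = \<alpha> i (\<alpha> (j - 1) x)"
      using twice[of i j] twice[of "j - 1" i] ij by simp
  }
  fix n :: int assume n: "0 \<le> n"
  show "linear_isometry_on scale' scale' (tower_limit (tower H \<iota>)) (tower_limit (tower H \<iota>)) (\<alpha> n)"
    using shifts[OF n] by (simp add: partial_shift_def)
  \<comment> \<open>On level \<open>n - 1\<close> the shift is the top map
    \<open>\<delta> n n\<close>, which the embeddings turn into an inclusion.\<close>
  show "\<alpha> n x = x" if "x \<in> tower H \<iota> (n - 1)" for x
    using that shift_emb[of n "n - 1"] emb_top[OF n] n by (auto simp: tower_def)
qed

theorem theorem2p14:
  fixes scale :: "'k::rc_scalar \<Rightarrow> 'a::banach \<Rightarrow> 'a" and ip :: "'a \<Rightarrow> 'a \<Rightarrow> 'k"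
    and H :: "int \<Rightarrow> 'a set" and \<delta> :: "int \<Rightarrow> int \<Rightarrow> 'a \<Rightarrow> 'a"
    and scale' :: "'k \<Rightarrow> 'b::banach \<Rightarrow> 'b" and ip' :: "'b \<Rightarrow> 'b \<Rightarrow> 'k"
    and \<iota> :: "int \<Rightarrow> 'a \<Rightarrow> 'b"
    and \<alpha> :: "int \<Rightarrow> 'b \<Rightarrow> 'b"
    and D T :: "int \<Rightarrow> 'b set"
  assumes SCH: "semi_cosimplicial_tower scale ip H \<delta> scale' ip' \<iota>"
    and shifts: "\<And>n. 0 \<le> n \<Longrightarrow> partial_shift scale' H \<delta> \<iota> n (\<alpha> n)"
  defines "T \<equiv> tower H \<iota>"
    and "D \<equiv> innovation ip' (tower H \<iota>)"
  shows
    "(\<forall>n\<ge>0.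
        ((\<forall>k\<ge>n. \<alpha> n ` D k \<subseteq> D (k + 1)) \<longrightarrow> saturated_at T \<alpha> (n - 1)) \<and>
        (saturated_at T \<alpha> (n - 1) \<longrightarrow> (\<forall>i. 0 \<le> i \<and> i \<le> n \<longrightarrow> \<alpha> i ` D n \<subseteq> D (n + 1)))) \<and>
     (saturated T \<alpha> \<longleftrightarrow> (\<forall>i n. 0 \<le> i \<and> i \<le> n \<longrightarrow> \<alpha> i ` D n \<subseteq> D (n + 1))) \<and>
     ((\<forall>i n. 0 \<le> i \<and> i \<le> n \<longrightarrow> \<alpha> i ` D n \<subseteq> D (n + 1)) \<longleftrightarrow> (\<forall>n\<ge>0. \<alpha> n ` D n \<subseteq> D (n + 1)))"
proof -
  interpret S: semi_cosimplicial_tower scale ip H \<delta> scale' ip' \<iota> by (rule SCH)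
  interpret shift_tower scale' ip' T \<alpha>
    unfolding T_def by (rule S.shift_tower_tower[OF shifts])
  have D: "D = innovation ip' T" by (simp add: D_def T_def)
  have I1: "saturated_at T \<alpha> (n - 1)" if "0 \<le> n" "\<forall>k\<ge>n. \<alpha> n ` D k \<subseteq> D (k + 1)" for n
    using saturated_at_of_shift_D[of n] that by (simp add: D)
  have I2: "\<alpha> i ` D n \<subseteq> D (n + 1)" if "0 \<le> i" "i \<le> n" "saturated_at T \<alpha> (n - 1)" for i n
    using shift_D_subset_of_saturated[of n i] that by (simp add: D)
  have II: "\<alpha> i ` D n \<subseteq> D (n + 1)" if "0 \<le> i" "i \<le> n" "\<forall>n\<ge>0. \<alpha> n ` D n \<subseteq> D (n + 1)" for i n
    using shift_D_subset_of_top[of n i] that by (simp add: D)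
  have "saturated T \<alpha> \<longleftrightarrow> (\<forall>n\<ge>0. saturated_at T \<alpha> (n - 1))"
  proof
    assume *: "\<forall>n\<ge>0. saturated_at T \<alpha> (n - 1)"
    show "saturated T \<alpha>" unfolding saturated_def
    proof (intro allI impI)
      fix m :: int assume "-1 \<le> m"
      then show "saturated_at T \<alpha> m" using *[rule_format, of "m + 1"] by simp
    qed
  qed (simp add: saturated_def)
  \<comment> \<open>For the backward direction, \<open>I1\<close> is fed the inclusions with shift
    index \<open>n\<close> and levels \<open>k \<ge> n\<close>.\<close>
  then have "saturated T \<alpha> \<longleftrightarrow> (\<forall>i n. 0 \<le> i \<and> i \<le> n \<longrightarrow> \<alpha> i ` D n \<subseteq> D (n + 1))"
    using I1 I2 by (meson order_trans)
  with I1 I2 II show ?thesis by (meson order_refl)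
qed

end
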